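(* Let $\alpha>2$, let $z\colon[t_0,+\infty)\to\mathcal H$ be a solution of the dynamical system (DS) described in the context, let $z_*\in\mathcal Z$, and assume that $\beta\colon[t_0,+\infty)\to(0,+\infty)$ satisfies $$0\le\sup_{t\ge t_0}\frac{t\dot\beta(t)}{\beta(t)}<\alpha-2.$$ Then $$\|\dot z(t)\|=o\Big(\frac1t\Big)\quad\text{as }t\to+\infty,$$ and $$\langle z(t)-z_*,V(z(t))\rangle=o\Big(\frac{1}{t\beta(t)}\Big)\quad\text{and}\quad\|V(z(t))\|=o\Big(\frac{1}{t\beta(t)}\Big)\quad\text{as }t\to+\infty.$$
   Context: $\mathcal H$ is a real Hilbert space, $V\colon\mathcal H\to\mathcal H$ is monotone ($\langle x-y,V(x)-V(y)\rangle\ge0$ for all $x,y\in\mathcal H$) and continuous, and $\mathcal Z:=\{z\in\mathcal H: V(z)=0\}$ is assumed nonempty. Let $t_0>0$, $(z^0,\dot z^0)\in\mathcal H\times\mathcal H$, and let $\beta\colon[t_0,+\infty)\to(0,+\infty)$ be continuously differentiable and nondecreasing. The dynamical system (DS) on $[t_0,+\infty)$ is $$\ddot z(t)+\frac{\alpha}{t}\dot z(t)+\beta(t)\frac{d}{dt}V(z(t))+\frac12\Big(\dot\beta(t)+\frac{\alpha}{t}\beta(t)\Big)V(z(t))=0,\qquad z(t_0)=z^0,\ \dot z(t_0)=\dot z^0.$$ For a solution $z$, the map $t\mapsto V(z(t))$ is assumed to be differentiable on $[t_0,+\infty)$. *)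

theory Defs
  imports "HOL-Analysis.Analysis" "HOL-Library.Landau_Symbols"
begin

definition monotone_operator :: "('a::real_inner \<Rightarrow> 'a) \<Rightarrow> bool" where
  "monotone_operator V \<longleftrightarrow> (\<forall>x y. 0 \<le> (x - y) \<bullet> (V x - V y))"

definition zeros :: "('a::zero \<Rightarrow> 'a) \<Rightarrow> 'a set" where
  "zeros V = {z. V z = 0}"

(* Functions on [t0, \<infinity>) are total functions whose values below t0 are irrelevant;
   hence the derivative at t0 is the one-sided one. *)
definition halfline_deriv :: "real \<Rightarrow> (real \<Rightarrow> 'a::real_normed_vector) \<Rightarrow> real \<Rightarrow> 'a" where
  "halfline_deriv t0 f t = vector_derivative f (at t within {t0..})"

definition continuously_differentiable_from :: "real \<Rightarrow> (real \<Rightarrow> real) \<Rightarrow> bool" where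
  "continuously_differentiable_from t0 f \<longleftrightarrow>
     f differentiable_on {t0..} \<and> continuous_on {t0..} (halfline_deriv t0 f)"

(* Classical solutions, satisfying the equation at every t \<ge> t0. Since vector_derivative is
   total, the third summand is only meaningful when V \<circ> z is differentiable; this is
   not part of the definition and has to be assumed separately. *)
definition DS_solution ::
  "real \<Rightarrow> real \<Rightarrow> (real \<Rightarrow> real) \<Rightarrow> ('a::real_normed_vector \<Rightarrow> 'a) \<Rightarrow> 'a \<Rightarrow> 'a \<Rightarrow> (real \<Rightarrow> 'a) \<Rightarrow> bool"
where
  "DS_solution t0 \<alpha> \<beta> V z0 v0 z \<longleftrightarrow>
     z differentiable_on {t0..} \<and>
     halfline_deriv t0 z differentiable_on {t0..} \<and>
     (\<forall>t\<ge>t0.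
        halfline_deriv t0 (halfline_deriv t0 z) t
        + (\<alpha> / t) *\<^sub>R halfline_deriv t0 z t
        + \<beta> t *\<^sub>R halfline_deriv t0 (\<lambda>s. V (z s)) t
        + (1 / 2 * (halfline_deriv t0 \<beta> t + \<alpha> / t * \<beta> t)) *\<^sub>R V (z t) = 0) \<and>
     z t0 = z0 \<and> halfline_deriv t0 z t0 = v0"

end

theory Submission
  imports Defs
begin

text \<open>
  Write \<open>x = z - z\<^sub>*\<close>, \<open>w = dz/dt\<close>, \<open>v = V(z)\<close>, \<open>r = (\<alpha> - 2) \<beta> - t \<beta>'\<close>. The growth condition on
  \<open>\<beta>\<close> says that \<open>r \<ge> \<epsilon> \<beta>\<close> for some \<open>\<epsilon> > 0\<close>, and monotonicity of \<open>V\<close> gives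
  \<open>\<langle>x, v\<rangle> \<ge> 0\<close> and \<open>\<langle>w, v'\<rangle> \<ge> 0\<close>. The proof rests on two functions along the trajectory:
  the residual energy
  \<open>R = t\<^sup>2/2 (\<parallel>2 w + \<beta> v\<parallel>\<^sup>2 + \<parallel>\<beta> v\<parallel>\<^sup>2)\<close>, which is what has to tend to \<open>0\<close>, and
  \<open>A = (\<alpha> - 1)/2 \<parallel>x\<parallel>\<^sup>2 + t \<langle>x, w\<rangle> + t \<beta> \<langle>x, v\<rangle>\<close>, which sees the distance to the zero \<open>z\<^sub>*\<close>.
  The differential equation yields
    \<open>A' = t \<parallel>w\<parallel>\<^sup>2 + t \<beta> \<langle>w, v\<rangle> - r/2 \<langle>x, v\<rangle>\<close> and
    \<open>R' = - 2 t\<^sup>2 \<beta> \<langle>w, v'\<rangle> - 4 (\<alpha> - 1) (t \<parallel>w\<parallel>\<^sup>2 + t \<beta> \<langle>w, v\<rangle>) - t \<beta> r \<parallel>v\<parallel>\<^sup>2\<close>.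
  Here the term \<open>t \<parallel>w\<parallel>\<^sup>2 + t \<beta> \<langle>w, v\<rangle>\<close> has no sign, but in \<open>E\<^sub>\<lambda> = 4 \<lambda> A + R\<close> it
  carries the factor \<open>- 4 c\<close> with \<open>c = \<alpha> - 1 - \<lambda>\<close>, and for \<open>0 \<le> c \<le> \<epsilon>/2\<close> the term
  \<open>- t \<beta> r \<parallel>v\<parallel>\<^sup>2\<close> absorbs it, which leaves \<open>E\<^sub>\<lambda>' \<le> - 2 c R / t\<close> (lemma \<open>energy_dissipation\<close>).
  On the other hand \<open>E\<^sub>\<lambda>\<close> is a sum of nonnegative terms, one of which is
  \<open>2 \<lambda> c \<parallel>x\<parallel>\<^sup>2\<close> (lemma \<open>energy_ge\<close>).

  Hence \<open>E\<^sub>\<lambda>\<close> decreases to a limit for every admissible \<open>\<lambda>\<close>. Because \<open>E\<^sub>\<lambda>\<close> is affine in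
  \<open>\<lambda>\<close>, two values of \<open>\<lambda>\<close> suffice to see that \<open>R\<close> itself converges. A limit \<open>L > 0\<close>
  would make \<open>E\<^sub>\<lambda>\<close>, for a \<open>\<lambda>\<close> with \<open>c > 0\<close>, decrease at least like a positive multiple of \<open>- ln t\<close>, which contradicts
  \<open>E\<^sub>\<lambda> \<ge> 0\<close>; so \<open>R\<close> tends to \<open>0\<close>. This is \<open>t \<parallel>w\<parallel> \<rightarrow> 0\<close> together with
  \<open>t \<beta> \<parallel>v\<parallel> \<rightarrow> 0\<close>, and since \<open>E\<^sub>\<lambda>\<close> also bounds \<open>\<parallel>x\<parallel>\<close>, the estimate for
  \<open>\<langle>x, v\<rangle>\<close> follows by Cauchy-Schwarz.

  Decay is deduced from signs of derivatives and never from integrals: the derivatives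
  \<open>dw/dt\<close> and \<open>v'\<close> are only known to exist pointwise and may fail to be continuous.
\<close>

section \<open>Preliminaries\<close>

lemma has_vector_derivative_inner:
  fixes f g :: "real \<Rightarrow> 'a::real_inner"
  assumes "(f has_vector_derivative f') (at t)" "(g has_vector_derivative g') (at t)"
  shows "((\<lambda>s. f s \<bullet> g s) has_real_derivative f t \<bullet> g' + f' \<bullet> g t) (at t)"
  using bounded_bilinear.has_vector_derivative[OF bounded_bilinear_inner assms]
  by (simp add: has_real_derivative_iff_has_vector_derivative)

lemma antimono_bounded_below_tendsto:
  fixes f :: "real \<Rightarrow> real"
  assumes anti: "\<And>s t. a < s \<Longrightarrow> s \<le> t \<Longrightarrow> f t \<le> f s"
    and lower: "\<And>t. a < t \<Longrightarrow> m \<le> f t"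
  obtains l where "(f \<longlongrightarrow> l) at_top"
proof
  let ?l = "Inf (f ` {a<..})"
  have bdd: "bdd_below (f ` {a<..})"
    by (rule bdd_belowI[of _ m]) (use lower in auto)
  show "(f \<longlongrightarrow> ?l) at_top"
  proof (rule decreasing_tendsto)
    show "\<forall>\<^sub>F t in at_top. ?l \<le> f t"
      using eventually_gt_at_top[of a] by eventually_elim (auto intro: cInf_lower bdd)
  next
    fix y assume "?l < y"
    then obtain s where s: "s > a" "f s < y"
      using cInf_less_iff[OF _ bdd] by auto
    show "\<forall>\<^sub>F t in at_top. f t < y"
      using eventually_ge_at_top[of s]
      by eventually_elim (use s anti in \<open>fastforce intro: le_less_trans\<close>)
  qed
qed

text \<open>The bound \<open>- k / t\<close> integrates to \<open>- k ln t\<close>, so \<open>f + k ln\<close> is nonincreasing.\<close>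

lemma no_logarithmic_decrease:
  fixes f :: "real \<Rightarrow> real"
  assumes "a > 0" "k > 0"
    and deriv: "\<And>t. t \<ge> a \<Longrightarrow> (f has_real_derivative f' t) (at t)"
    and le: "\<And>t. t \<ge> a \<Longrightarrow> f' t \<le> - k / t"
    and lower: "\<And>t. t \<ge> a \<Longrightarrow> m \<le> f t"
  shows False
proof -
  have decr: "f t + k * ln t \<le> f a + k * ln a" if "t \<ge> a" for t
  proof (rule DERIV_nonpos_imp_nonincreasing[OF that])
    fix s assume s: "a \<le> s" "s \<le> t"
    have "((\<lambda>t. f t + k * ln t) has_real_derivative f' s + k * (1 / s)) (at s)"
      using s \<open>a > 0\<close> by (auto intro!: derivative_eq_intros deriv)
    moreover have "f' s + k * (1 / s) \<le> 0"
      using le[OF s(1)] by simp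
    ultimately show "\<exists>y. ((\<lambda>t. f t + k * ln t) has_real_derivative y) (at s) \<and> y \<le> 0"
      by blast
  qed
  have "filterlim (\<lambda>t::real. k * ln t) at_top at_top"
    using ln_at_top \<open>k > 0\<close> by (intro filterlim_tendsto_pos_mult_at_top[OF tendsto_const])
  then have "\<forall>\<^sub>F t in at_top. k * ln t > f a + k * ln a - m"
    by (simp add: filterlim_at_top_dense)
  then have "\<forall>\<^sub>F t::real in at_top. False"
    using eventually_ge_at_top[of a]
  proof eventually_elim
    case (elim t)
    then show False using decr[of t] lower[of t] by simp
  qed
  then show False by simp
qed

text \<open>
  The infinitesimal form of monotonicity along a trajectory: the inner product is the limit of
  \<open>\<langle>z(t + h) - z(t), V(z(t + h)) - V(z(t))\<rangle> / h\<^sup>2\<close>.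
\<close>

lemma monotone_operator_deriv_nonneg:
  fixes V :: "'a::real_inner \<Rightarrow> 'a"
  assumes "monotone_operator V"
    and z: "(z has_vector_derivative z') (at t)"
    and Vz: "((\<lambda>s. V (z s)) has_vector_derivative v') (at t)"
  shows "0 \<le> z' \<bullet> v'"
proof -
  let ?q = "\<lambda>h. ((z (t + h) - z t) /\<^sub>R h) \<bullet> ((V (z (t + h)) - V (z t)) /\<^sub>R h)"
  have quotient: "((\<lambda>h. (f (t + h) - f t) /\<^sub>R h) \<longlongrightarrow> f') (at 0)"
    if "(f has_vector_derivative f') (at t)" for f :: "real \<Rightarrow> 'a" and f'
  proof -
    have "((\<lambda>h. norm ((f (t + h) - f t - h *\<^sub>R f') /\<^sub>R h)) \<longlongrightarrow> 0) (at 0)"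
      using that by (simp add: has_vector_derivative_def has_derivative_at divide_inverse mult.commute)
    then have "((\<lambda>h. (f (t + h) - f t - h *\<^sub>R f') /\<^sub>R h) \<longlongrightarrow> 0) (at 0)"
      by (rule tendsto_norm_zero_cancel)
    then have "((\<lambda>h. (f (t + h) - f t) /\<^sub>R h - f') \<longlongrightarrow> 0) (at 0)"
      by (rule Lim_transform_eventually)
        (auto simp: eventually_at_filter scaleR_diff_right)
    then show ?thesis
      by (rule LIM_zero_cancel)
  qed
  from quotient[OF z] quotient[OF Vz] have "(?q \<longlongrightarrow> z' \<bullet> v') (at 0)"
    by (rule tendsto_inner)
  moreover have "0 \<le> ?q h" for h
    using assms(1) by (simp add: monotone_operator_def flip: mult.assoc)
  ultimately show ?thesis
    by (intro tendsto_lowerbound) auto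
qed

section \<open>Energies along a trajectory\<close>

text \<open>
  The parts of the problem that the energy estimates use, with \<open>x\<close> for \<open>z - z\<^sub>*\<close>. The equation
  is solved for the second derivative of \<open>z\<close>, and \<open>\<epsilon>\<close> measures the gap in the growth condition.
  Everything is required on the open half-line only, where one-sided derivatives do not occur.
\<close>

locale monotone_flow =
  fixes x w v v' :: "real \<Rightarrow> 'a::real_inner"
    and \<beta> \<beta>' :: "real \<Rightarrow> real"
    and \<alpha> \<epsilon> t0 :: real
  assumes t0: "t0 > 0"
    and eps: "\<epsilon> > 0" "\<epsilon> < \<alpha> - 1"
    and x_deriv: "\<And>t. t > t0 \<Longrightarrow> (x has_vector_derivative w t) (at t)"
    and w_deriv: "\<And>t. t > t0 \<Longrightarrow> (w has_vector_derivative
          - ((\<alpha> / t) *\<^sub>R w t + \<beta> t *\<^sub>R v' t + (1 / 2 * (\<beta>' t + \<alpha> / t * \<beta> t)) *\<^sub>R v t)) (at t)"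
    and v_deriv: "\<And>t. t > t0 \<Longrightarrow> (v has_vector_derivative v' t) (at t)"
    and beta_deriv: "\<And>t. t > t0 \<Longrightarrow> (\<beta> has_real_derivative \<beta>' t) (at t)"
    and beta_pos: "\<And>t. t > t0 \<Longrightarrow> \<beta> t > 0"
    and growth: "\<And>t. t > t0 \<Longrightarrow> \<epsilon> * \<beta> t \<le> (\<alpha> - 2) * \<beta> t - t * \<beta>' t"
    and xv_nonneg: "\<And>t. t > t0 \<Longrightarrow> 0 \<le> x t \<bullet> v t"
    and wv_nonneg: "\<And>t. t > t0 \<Longrightarrow> 0 \<le> w t \<bullet> v' t"
begin

definition anchored :: "real \<Rightarrow> real" where
  "anchored t = (\<alpha> - 1) / 2 * (x t \<bullet> x t) + t * (x t \<bullet> w t) + t * \<beta> t * (x t \<bullet> v t)"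

definition residual :: "real \<Rightarrow> real" where
  "residual t = t\<^sup>2 / 2 * ((norm (2 *\<^sub>R w t + \<beta> t *\<^sub>R v t))\<^sup>2 + (norm (\<beta> t *\<^sub>R v t))\<^sup>2)"

definition energy :: "real \<Rightarrow> real \<Rightarrow> real" where
  "energy l t = 4 * l * anchored t + residual t"

definition energy' :: "real \<Rightarrow> real \<Rightarrow> real" where
  "energy' l t =
     - 2 * l * ((\<alpha> - 2) * \<beta> t - t * \<beta>' t) * (x t \<bullet> v t)
     - 2 * t\<^sup>2 * \<beta> t * (w t \<bullet> v' t)
     - 4 * (\<alpha> - 1 - l) * t * (w t \<bullet> w t + \<beta> t * (w t \<bullet> v t))
     - t * \<beta> t * ((\<alpha> - 2) * \<beta> t - t * \<beta>' t) * (v t \<bullet> v t)"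

lemma residual_nonneg: "0 \<le> residual t"
  by (simp add: residual_def)

lemma residual_expand:
  "residual t = t\<^sup>2 * (2 * (w t \<bullet> w t) + 2 * \<beta> t * (w t \<bullet> v t) + (\<beta> t)\<^sup>2 * (v t \<bullet> v t))"
  unfolding residual_def power2_norm_eq_inner
  by (simp add: inner_simps inner_commute[of "v t" "w t"] power2_eq_square algebra_simps)

lemma anchored_deriv:
  assumes "t > t0"
  shows "(anchored has_real_derivative
           t * (w t \<bullet> w t) + t * \<beta> t * (w t \<bullet> v t)
           - ((\<alpha> - 2) * \<beta> t - t * \<beta>' t) / 2 * (x t \<bullet> v t)) (at t)"
proof -
  note ders = x_deriv[OF assms] w_deriv[OF assms] v_deriv[OF assms]
  have "t \<noteq> 0" using assms t0 by simp
  show ?thesis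
    unfolding anchored_def[abs_def]
    by (rule derivative_eq_intros refl has_vector_derivative_inner ders beta_deriv[OF assms])+
      (use \<open>t \<noteq> 0\<close> in \<open>simp add: inner_simps inner_commute[of "w t" "x t"] field_simps\<close>)
qed

lemma residual_deriv:
  assumes "t > t0"
  shows "(residual has_real_derivative
           - 2 * t\<^sup>2 * \<beta> t * (w t \<bullet> v' t)
           - 4 * (\<alpha> - 1) * t * (w t \<bullet> w t + \<beta> t * (w t \<bullet> v t))
           - t * \<beta> t * ((\<alpha> - 2) * \<beta> t - t * \<beta>' t) * (v t \<bullet> v t)) (at t)"
proof -
  note ders = w_deriv[OF assms] v_deriv[OF assms]
  have "t \<noteq> 0" using assms t0 by simp
  show ?thesis
    unfolding residual_expand[abs_def]
    by (rule derivative_eq_intros refl has_vector_derivative_inner ders beta_deriv[OF assms])+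
      (use \<open>t \<noteq> 0\<close> in \<open>simp add: inner_simps inner_commute[of "v t" "w t"]
        inner_commute[of "v' t" "w t"] inner_commute[of "v' t" "v t"] field_simps power2_eq_square\<close>)
qed

lemma energy_deriv:
  assumes "t > t0"
  shows "(energy l has_real_derivative energy' l t) (at t)"
  unfolding energy_def[abs_def] energy'_def
  by (rule derivative_eq_intros refl anchored_deriv[OF assms] residual_deriv[OF assms])+
    (simp add: field_simps)

text \<open>
  Completing the square turns the cross terms of \<open>anchored\<close> and \<open>residual\<close> into
  \<open>1/2 \<parallel>2 \<lambda> x + t (2 w + \<beta> v)\<parallel>\<^sup>2\<close>, at the cost of \<open>2 \<lambda>\<^sup>2 \<parallel>x\<parallel>\<^sup>2\<close>, which is taken from the
  available \<open>2 \<lambda> (\<alpha> - 1) \<parallel>x\<parallel>\<^sup>2\<close>. The bound is nonnegative as long as \<open>\<lambda> \<le> \<alpha> - 1\<close>.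
\<close>

lemma energy_ge:
  assumes "t > t0" "0 \<le> l"
  shows "2 * l * (\<alpha> - 1 - l) * (norm (x t))\<^sup>2 \<le> energy l t"
proof -
  let ?u = "(2 * l) *\<^sub>R x t + t *\<^sub>R (2 *\<^sub>R w t + \<beta> t *\<^sub>R v t)"
  have "energy l t = 1 / 2 * (?u \<bullet> ?u) + 2 * l * (\<alpha> - 1 - l) * (x t \<bullet> x t)
          + 2 * l * t * \<beta> t * (x t \<bullet> v t) + 1 / 2 * t\<^sup>2 * (\<beta> t)\<^sup>2 * (v t \<bullet> v t)"
    unfolding energy_def anchored_def residual_expand
    by (simp add: inner_simps inner_commute[of "w t" "x t"] inner_commute[of "v t" "x t"]
        inner_commute[of "v t" "w t"] power2_eq_square field_simps)
  moreover have "0 \<le> 2 * l * t * \<beta> t * (x t \<bullet> v t)"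
    using assms t0 beta_pos[OF assms(1)] xv_nonneg[OF assms(1)] by simp
  moreover have "0 \<le> 1 / 2 * t\<^sup>2 * (\<beta> t)\<^sup>2 * (v t \<bullet> v t)" "0 \<le> 1 / 2 * (?u \<bullet> ?u)"
    by simp_all
  ultimately show ?thesis
    unfolding power2_norm_eq_inner by linarith
qed

text \<open>
  With \<open>c = \<alpha> - 1 - \<lambda>\<close> and \<open>y = \<beta> v\<close> the quadratic part of the dissipation, divided by \<open>t\<close>,
  is at least \<open>4 c \<parallel>w\<parallel>\<^sup>2 + 4 c \<langle>w, y\<rangle> + \<epsilon> \<parallel>y\<parallel>\<^sup>2 = 4 c \<parallel>w + y/2\<parallel>\<^sup>2 + (\<epsilon> - c) \<parallel>y\<parallel>\<^sup>2\<close>, whereas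
  \<open>residual t / t\<^sup>2 = 2 \<parallel>w + y/2\<parallel>\<^sup>2 + 1/2 \<parallel>y\<parallel>\<^sup>2\<close>. The factor between the two is \<open>2 c\<close> as soon as
  \<open>\<epsilon> - c \<ge> c\<close>.
\<close>

lemma energy_dissipation:
  assumes "t > t0" "0 \<le> l" "2 * (\<alpha> - 1 - l) \<le> \<epsilon>"
  shows "energy' l t \<le> - 2 * (\<alpha> - 1 - l) * residual t / t"
proof -
  define c where "c = \<alpha> - 1 - l"
  define r where "r = (\<alpha> - 2) * \<beta> t - t * \<beta>' t"
  have t: "t > 0" and b: "\<beta> t > 0"
    using assms t0 beta_pos by auto
  have r: "\<epsilon> * \<beta> t \<le> r"
    using growth[OF assms(1)] by (simp add: r_def)
  then have "0 \<le> r"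
    using b eps by (meson dual_order.trans less_imp_le mult_nonneg_nonneg)
  then have *: "0 \<le> 2 * l * r * (x t \<bullet> v t)" "0 \<le> 2 * t\<^sup>2 * \<beta> t * (w t \<bullet> v' t)"
    using assms xv_nonneg[OF assms(1)] wv_nonneg[OF assms(1)] b by simp_all
  have "2 * c * \<beta> t \<le> r"
    using r assms(3) b unfolding c_def by (smt (verit) mult_right_mono)
  then have "t * \<beta> t * (2 * c * \<beta> t) * (v t \<bullet> v t) \<le> t * \<beta> t * r * (v t \<bullet> v t)"
    using t b by (intro mult_right_mono mult_left_mono) auto
  moreover have "2 * c * residual t / t
      = 4 * c * t * (w t \<bullet> w t + \<beta> t * (w t \<bullet> v t)) + t * \<beta> t * (2 * c * \<beta> t) * (v t \<bullet> v t)"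
    using t unfolding residual_expand by (simp add: field_simps power2_eq_square)
  moreover have "energy' l t = - (2 * l * r * (x t \<bullet> v t)) - 2 * t\<^sup>2 * \<beta> t * (w t \<bullet> v' t)
      - 4 * c * t * (w t \<bullet> w t + \<beta> t * (w t \<bullet> v t)) - t * \<beta> t * r * (v t \<bullet> v t)"
    by (simp add: energy'_def c_def r_def)
  ultimately show ?thesis
    using * unfolding c_def[symmetric] by linarith
qed

lemma energy_nonneg:
  assumes "t > t0" "0 \<le> l" "l \<le> \<alpha> - 1"
  shows "0 \<le> energy l t"
proof -
  have "0 \<le> 2 * l * (\<alpha> - 1 - l) * (norm (x t))\<^sup>2"
    using assms by simp
  then show ?thesis
    using energy_ge[OF assms(1,2)] by linarith
qed

lemma energy_antimono:
  assumes l: "0 \<le> l" "l \<le> \<alpha> - 1" "2 * (\<alpha> - 1 - l) \<le> \<epsilon>" and "t0 < s" "s \<le> t"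
  shows "energy l t \<le> energy l s"
proof (rule DERIV_nonpos_imp_nonincreasing[OF \<open>s \<le> t\<close>])
  fix q assume "s \<le> q" "q \<le> t"
  then have q: "q > t0" "q > 0" using assms t0 by auto
  have "0 \<le> 2 * (\<alpha> - 1 - l) * residual q / q"
    using l q residual_nonneg[of q] by simp
  then have "energy' l q \<le> 0"
    using energy_dissipation[OF q(1) l(1,3)] by linarith
  then show "\<exists>y. (energy l has_real_derivative y) (at q) \<and> y \<le> 0"
    using energy_deriv[OF q(1)] by blast
qed

section \<open>Decay\<close>

lemma energy_convergent:
  assumes "0 \<le> l" "l \<le> \<alpha> - 1" "2 * (\<alpha> - 1 - l) \<le> \<epsilon>"
  obtains e where "(energy l \<longlongrightarrow> e) at_top"
  using antimono_bounded_below_tendsto[of t0 "energy l" 0]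
    energy_antimono[OF assms] energy_nonneg[OF _ assms(1,2)] by blast

text \<open>
  The residual is not monotone; it converges because it is a fixed linear combination of the
  energies for two different parameters.
\<close>

lemma residual_convergent:
  obtains L where "(residual \<longlongrightarrow> L) at_top"
proof -
  define l1 l2 where "l1 = \<alpha> - 1 - \<epsilon> / 2" and "l2 = \<alpha> - 1"
  obtain e1 where e1: "(energy l1 \<longlongrightarrow> e1) at_top"
    by (rule energy_convergent[of l1]) (use eps in \<open>auto simp: l1_def\<close>)
  obtain e2 where e2: "(energy l2 \<longlongrightarrow> e2) at_top"
    by (rule energy_convergent[of l2]) (use eps in \<open>auto simp: l2_def\<close>)
  have "l2 - l1 \<noteq> 0"
    using eps by (simp add: l1_def l2_def)
  then have "residual = (\<lambda>t. (l2 * energy l1 t - l1 * energy l2 t) / (l2 - l1))"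
    by (auto simp: energy_def field_simps)
  moreover have "((\<lambda>t. (l2 * energy l1 t - l1 * energy l2 t) / (l2 - l1))
      \<longlongrightarrow> (l2 * e1 - l1 * e2) / (l2 - l1)) at_top"
    by (intro tendsto_intros e1 e2 \<open>l2 - l1 \<noteq> 0\<close>)
  ultimately show thesis
    using that by metis
qed

theorem residual_tendsto_zero: "(residual \<longlongrightarrow> 0) at_top"
proof -
  obtain L where L: "(residual \<longlongrightarrow> L) at_top"
    by (rule residual_convergent)
  have "0 \<le> L"
    by (rule tendsto_lowerbound[OF L]) (auto simp: residual_nonneg)
  moreover have "\<not> L > 0"
  proof
    assume "L > 0"
    then have "\<forall>\<^sub>F t in at_top. residual t > L / 2"
      using L by (intro order_tendstoD) auto
    then obtain a0 where a0: "\<And>t. t \<ge> a0 \<Longrightarrow> residual t > L / 2"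
      by (auto simp: eventually_at_top_linorder)
    define a where "a = max a0 (t0 + 1)"
    define l where "l = \<alpha> - 1 - \<epsilon> / 2"
    have l: "0 \<le> l" "l \<le> \<alpha> - 1" "2 * (\<alpha> - 1 - l) \<le> \<epsilon>"
      using eps by (auto simp: l_def)
    have a: "t > t0" "t > 0" "residual t > L / 2" if "t \<ge> a" for t
      using that a0[of t] t0 by (auto simp: a_def)
    show False
    proof (rule no_logarithmic_decrease)
      show "a > 0" using t0 by (auto simp: a_def)
      show "\<epsilon> * L / 2 > 0" using eps \<open>L > 0\<close> by simp
      show "(energy l has_real_derivative energy' l t) (at t)" if "t \<ge> a" for t
        using energy_deriv a[OF that] by blast
      show "0 \<le> energy l t" if "t \<ge> a" for t
        using energy_nonneg[OF _ l(1,2)] a[OF that] by blast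
      show "energy' l t \<le> - (\<epsilon> * L / 2) / t" if "t \<ge> a" for t
      proof -
        have "\<epsilon> * (L / 2) / t \<le> \<epsilon> * residual t / t"
          using a[OF that] eps by (intro divide_right_mono mult_left_mono) auto
        then show ?thesis
          using energy_dissipation[OF a(1)[OF that] l(1,3)] by (simp add: l_def)
      qed
    qed
  qed
  ultimately show ?thesis
    using L by (metis order_less_le)
qed

lemma x_bounded:
  obtains M where "\<forall>\<^sub>F t in at_top. norm (x t) \<le> M"
proof
  define l where "l = \<alpha> - 1 - \<epsilon> / 2"
  have l: "0 \<le> l" "l \<le> \<alpha> - 1" "2 * (\<alpha> - 1 - l) \<le> \<epsilon>"
    using eps by (auto simp: l_def)
  have k: "0 < 2 * l * (\<alpha> - 1 - l)"
    using eps by (simp add: l_def)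
  show "\<forall>\<^sub>F t in at_top. norm (x t) \<le> sqrt (energy l (t0 + 1) / (2 * l * (\<alpha> - 1 - l)))"
    using eventually_ge_at_top[of "t0 + 1"]
  proof eventually_elim
    case (elim t)
    have "2 * l * (\<alpha> - 1 - l) * (norm (x t))\<^sup>2 \<le> energy l (t0 + 1)"
      using energy_ge[of t l] energy_antimono[OF l, of "t0 + 1" t] l elim by simp
    then show ?case
      using k by (intro real_le_rsqrt) (simp add: pos_le_divide_eq mult.commute)
  qed
qed

lemma sqrt_residual_decay: "((\<lambda>t. sqrt (2 * residual t)) \<longlongrightarrow> 0) at_top"
  using tendsto_real_sqrt[OF tendsto_mult_right_zero[OF residual_tendsto_zero, of 2]] by simp

lemma beta_v_decay: "((\<lambda>t. t * \<beta> t * norm (v t)) \<longlongrightarrow> 0) at_top"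
proof (rule tendsto_sandwich[where f = "\<lambda>_. 0"])
  show "((\<lambda>t. sqrt (2 * residual t)) \<longlongrightarrow> 0) at_top"
    by (rule sqrt_residual_decay)
  show "\<forall>\<^sub>F t in at_top. t * \<beta> t * norm (v t) \<le> sqrt (2 * residual t)"
    by (intro always_eventually allI real_le_rsqrt)
      (simp add: residual_def power_mult_distrib algebra_simps)
  show "\<forall>\<^sub>F t in at_top. 0 \<le> t * \<beta> t * norm (v t)"
    using eventually_gt_at_top[of t0]
  proof eventually_elim
    case (elim t)
    then show ?case using t0 beta_pos[of t] by simp
  qed
qed simp

lemma w_decay: "((\<lambda>t. t * norm (w t)) \<longlongrightarrow> 0) at_top"
proof (rule tendsto_sandwich[where f = "\<lambda>_. 0"])
  show "((\<lambda>t. (sqrt (2 * residual t) + t * \<beta> t * norm (v t)) / 2) \<longlongrightarrow> 0) at_top"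
    using tendsto_divide[OF tendsto_add[OF sqrt_residual_decay beta_v_decay] tendsto_const[of 2]]
    by simp
  show "\<forall>\<^sub>F t in at_top. t * norm (w t) \<le> (sqrt (2 * residual t) + t * \<beta> t * norm (v t)) / 2"
    using eventually_gt_at_top[of t0]
  proof eventually_elim
    case (elim t)
    then have t: "t > 0" "\<beta> t > 0" using t0 beta_pos by auto
    have "t * norm (2 *\<^sub>R w t + \<beta> t *\<^sub>R v t) \<le> sqrt (2 * residual t)"
      by (rule real_le_rsqrt) (simp add: residual_def power_mult_distrib algebra_simps)
    moreover have "2 * norm (w t) \<le> norm (2 *\<^sub>R w t + \<beta> t *\<^sub>R v t) + \<beta> t * norm (v t)"
      using norm_triangle_ineq4[of "2 *\<^sub>R w t + \<beta> t *\<^sub>R v t" "\<beta> t *\<^sub>R v t"] t by simp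
    then have "t * (2 * norm (w t))
        \<le> t * (norm (2 *\<^sub>R w t + \<beta> t *\<^sub>R v t) + \<beta> t * norm (v t))"
      using t by (intro mult_left_mono) auto
    ultimately show ?case
      by (simp add: algebra_simps)
  qed
  show "\<forall>\<^sub>F t in at_top. 0 \<le> t * norm (w t)"
    using eventually_gt_at_top[of 0] by eventually_elim simp
qed simp

lemma xv_decay: "((\<lambda>t. t * \<beta> t * (x t \<bullet> v t)) \<longlongrightarrow> 0) at_top"
proof -
  obtain M where M: "\<forall>\<^sub>F t in at_top. norm (x t) \<le> M"
    by (rule x_bounded)
  show ?thesis
  proof (rule tendsto_sandwich[where f = "\<lambda>_. 0"])
    show "((\<lambda>t. M * (t * \<beta> t * norm (v t))) \<longlongrightarrow> 0) at_top"
      using tendsto_mult_left[OF beta_v_decay, of M] by simp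
    show "\<forall>\<^sub>F t in at_top. t * \<beta> t * (x t \<bullet> v t) \<le> M * (t * \<beta> t * norm (v t))"
      using M eventually_gt_at_top[of t0]
    proof eventually_elim
      case (elim t)
      have "x t \<bullet> v t \<le> M * norm (v t)"
        using norm_cauchy_schwarz[of "x t" "v t"] mult_right_mono[OF elim(1), of "norm (v t)"]
        by simp
      then have "t * \<beta> t * (x t \<bullet> v t) \<le> t * \<beta> t * (M * norm (v t))"
        using elim t0 beta_pos[of t] by (intro mult_left_mono) auto
      then show ?case by (simp add: algebra_simps)
    qed
    show "\<forall>\<^sub>F t in at_top. 0 \<le> t * \<beta> t * (x t \<bullet> v t)"
      using eventually_gt_at_top[of t0]
    proof eventually_elim
      case (elim t)
      then show ?case using t0 beta_pos[of t] xv_nonneg[of t] by simp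
    qed
  qed simp
qed

end

section \<open>Convergence rates for the dynamical system\<close>

lemma halfline_deriv_works:
  assumes "f differentiable_on {t0..}" "t > t0"
  shows "(f has_vector_derivative halfline_deriv t0 f t) (at t)"
proof -
  have "at t within {t0..} = at t"
    using assms(2) by (intro at_within_interior) auto
  moreover have "f differentiable (at t within {t0..})"
    using assms by (simp add: differentiable_on_def)
  ultimately show ?thesis
    by (simp add: halfline_deriv_def vector_derivative_works)
qed

lemma smallo_recip_iff:
  fixes f g :: "real \<Rightarrow> real"
  assumes "\<forall>\<^sub>F t in at_top. g t > 0"
  shows "f \<in> o[at_top](\<lambda>t. 1 / g t) \<longleftrightarrow> ((\<lambda>t. g t * f t) \<longlongrightarrow> 0) at_top"
proof -
  have "\<forall>\<^sub>F t in at_top. 1 / g t \<noteq> 0"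
    using assms by eventually_elim simp
  then show ?thesis
    using smalloI_tendsto[of f "\<lambda>t. 1 / g t" at_top] smalloD_tendsto[of f at_top "\<lambda>t. 1 / g t"]
    by (auto simp: mult.commute)
qed

theorem theorem7:
  fixes V :: "'a::{real_inner, complete_space} \<Rightarrow> 'a"
    and z :: "real \<Rightarrow> 'a"
    and z0 v0 z_star :: 'a
    and \<beta> :: "real \<Rightarrow> real"
    and \<alpha> t0 :: real
  assumes "monotone_operator V"
    and "continuous_on UNIV V"
    and "t0 > 0"
    and "\<And>t. t \<ge> t0 \<Longrightarrow> \<beta> t > 0"
    and "continuously_differentiable_from t0 \<beta>"
    and "mono_on {t0..} \<beta>"
    and "\<alpha> > 2"
    and "DS_solution t0 \<alpha> \<beta> V z0 v0 z"
    and "(\<lambda>t. V (z t)) differentiable_on {t0..}"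
    and "z_star \<in> zeros V"
    and "0 \<le> (SUP t\<in>{t0..}. ereal (t * halfline_deriv t0 \<beta> t / \<beta> t))"
    and "(SUP t\<in>{t0..}. ereal (t * halfline_deriv t0 \<beta> t / \<beta> t)) < ereal (\<alpha> - 2)"
  shows "(\<lambda>t. norm (halfline_deriv t0 z t)) \<in> o[at_top](\<lambda>t. 1 / t) \<and>
         (\<lambda>t. (z t - z_star) \<bullet> V (z t)) \<in> o[at_top](\<lambda>t. 1 / (t * \<beta> t)) \<and>
         (\<lambda>t. norm (V (z t))) \<in> o[at_top](\<lambda>t. 1 / (t * \<beta> t))"
proof -
  let ?S = "SUP t\<in>{t0..}. ereal (t * halfline_deriv t0 \<beta> t / \<beta> t)"
  obtain s where s: "?S < ereal s" "s < \<alpha> - 2"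
    using ereal_dense2[OF assms(12)] by auto
  have "0 \<le> s"
    using assms(11) s(1) by (metis ereal_less_eq(3) le_less_trans less_imp_le zero_ereal_def)
  have quotient: "t * halfline_deriv t0 \<beta> t / \<beta> t \<le> s" if "t > t0" for t
  proof -
    have "ereal (t * halfline_deriv t0 \<beta> t / \<beta> t) \<le> ?S"
      by (rule SUP_upper) (use that in auto)
    then show ?thesis
      using s(1) by (metis ereal_less_eq(3) le_less_trans less_imp_le)
  qed
  have z: "z differentiable_on {t0..}" "halfline_deriv t0 z differentiable_on {t0..}"
    and eq: "\<And>t. t \<ge> t0 \<Longrightarrow> halfline_deriv t0 (halfline_deriv t0 z) t
        + (\<alpha> / t) *\<^sub>R halfline_deriv t0 z t
        + \<beta> t *\<^sub>R halfline_deriv t0 (\<lambda>s. V (z s)) t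
        + (1 / 2 * (halfline_deriv t0 \<beta> t + \<alpha> / t * \<beta> t)) *\<^sub>R V (z t) = 0"
    using assms(8) by (auto simp: DS_solution_def)
  have \<beta>: "\<beta> differentiable_on {t0..}"
    using assms(5) by (simp add: continuously_differentiable_from_def)
  interpret monotone_flow "\<lambda>t. z t - z_star" "halfline_deriv t0 z" "\<lambda>t. V (z t)"
    "halfline_deriv t0 (\<lambda>t. V (z t))" \<beta> "halfline_deriv t0 \<beta>" \<alpha> "\<alpha> - 2 - s" t0
  proof
    show "t0 > 0" by fact
    show "0 < \<alpha> - 2 - s" "\<alpha> - 2 - s < \<alpha> - 1"
      using s \<open>0 \<le> s\<close> by auto
    fix t assume t: "t0 < t"
    note z_deriv = halfline_deriv_works[OF z(1) t]
    show "((\<lambda>t. z t - z_star) has_vector_derivative halfline_deriv t0 z t) (at t)"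
      using has_vector_derivative_diff[OF z_deriv has_vector_derivative_const[of z_star]] by simp
    show "(halfline_deriv t0 z has_vector_derivative
        - ((\<alpha> / t) *\<^sub>R halfline_deriv t0 z t + \<beta> t *\<^sub>R halfline_deriv t0 (\<lambda>t. V (z t)) t
           + (1 / 2 * (halfline_deriv t0 \<beta> t + \<alpha> / t * \<beta> t)) *\<^sub>R V (z t))) (at t)"
      (is "(_ has_vector_derivative - ?rhs) _")
    proof -
      have "halfline_deriv t0 (halfline_deriv t0 z) t + ?rhs = 0"
        using eq[of t] t by (simp add: add.assoc)
      then have "halfline_deriv t0 (halfline_deriv t0 z) t = - ?rhs"
        by (simp only: eq_neg_iff_add_eq_0)
      then show ?thesis
        using halfline_deriv_works[OF z(2) t] by simp
    qed
    show Vz_deriv: "((\<lambda>t. V (z t)) has_vector_derivative halfline_deriv t0 (\<lambda>t. V (z t)) t) (at t)"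
      by (rule halfline_deriv_works[OF assms(9) t])
    show "(\<beta> has_real_derivative halfline_deriv t0 \<beta> t) (at t)"
      using halfline_deriv_works[OF \<beta> t]
      by (simp add: has_real_derivative_iff_has_vector_derivative)
    show "\<beta> t > 0" using assms(4) t by simp
    then show "(\<alpha> - 2 - s) * \<beta> t \<le> (\<alpha> - 2) * \<beta> t - t * halfline_deriv t0 \<beta> t"
      using quotient[OF t] by (simp add: field_simps)
    show "0 \<le> (z t - z_star) \<bullet> V (z t)"
      using assms(1,10) by (auto simp: monotone_operator_def zeros_def dest: spec2[of _ "z t" z_star])
    show "0 \<le> halfline_deriv t0 z t \<bullet> halfline_deriv t0 (\<lambda>t. V (z t)) t"
      by (rule monotone_operator_deriv_nonneg[OF assms(1) z_deriv Vz_deriv])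
  qed
  have "\<forall>\<^sub>F t in at_top. t * \<beta> t > 0"
    using eventually_gt_at_top[of t0] by eventually_elim (use assms(3,4) in simp)
  then show ?thesis
    using w_decay xv_decay beta_v_decay eventually_gt_at_top[of "0::real"]
    by (simp add: smallo_recip_iff)
qed

end
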